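(* A completely regular frame $L$ is perfectly regular if and only if $L$ has no proper dense well-embedded sublocales.
   Context: An element $a$ of a frame $L$ is a cozero element if $a=h(\mathbb{R}\setminus\{0\})$ for some frame homomorphism $h:\mathfrak{O}\mathbb{R}\to L$; $\mathrm{Coz}\,L$ is the set of cozero elements of $L$. A frame $L$ is completely regular iff every element of $L$ is a join of cozero elements; it is perfectly regular if every element is a join of cozero elements and every element is a meet of cozero elements. A sublocale of $L$ is a subset $S\subseteq L$ closed under arbitrary meets such that $x\to s\in S$ for all $x\in L$, $s\in S$, where $\to$ is the Heyting implication of $L$; with the induced order a sublocale is itself a frame. A sublocale $S$ is dense if $0_L\in S$, and proper if $S\neq L$. A dense sublocale $S$ of a completely regular frame $L$ is well-embedded iff $\mathrm{Coz}\,L\subseteq\mathrm{Coz}\,S$ (as subsets of $L$). *)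

theory Defs
  imports "HOL-Algebra.Complete_Lattice" "HOL-Analysis.Abstract_Topology"
begin

locale frame = complete_lattice L for L (structure) +
  assumes meet_sup_distrib:
    "\<lbrakk>a \<in> carrier L; B \<subseteq> carrier L\<rbrakk> \<Longrightarrow> a \<sqinter> \<Squnion>B = \<Squnion>((\<lambda>b. a \<sqinter> b) ` B)"

text \<open>Preservation of the bottom element is the empty-join instance of \<open>sup_pres\<close>;
  preservation of the top element does not follow from \<open>meet_pres\<close>.\<close>

definition frame_hom ::
    "('a, 'c) gorder_scheme \<Rightarrow> ('b, 'd) gorder_scheme \<Rightarrow> ('a \<Rightarrow> 'b) \<Rightarrow> bool" where
  "frame_hom M L h \<longleftrightarrow>
     h \<in> carrier M \<rightarrow> carrier L \<and> sup_pres M L h \<and> meet_pres M L h \<and> h \<top>\<^bsub>M\<^esub> = \<top>\<^bsub>L\<^esub>"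

definition opens :: "'x topology \<Rightarrow> 'x set gorder" where
  "opens T = \<lparr>carrier = {U. openin T U}, eq = (=), le = (\<subseteq>)\<rparr>"

definition Coz :: "('a, 'b) gorder_scheme \<Rightarrow> 'a set" where
  "Coz L = {h (UNIV - {0}) |h. frame_hom (opens (euclidean :: real topology)) L h}"

definition completely_regular :: "('a, 'b) gorder_scheme \<Rightarrow> bool" where
  "completely_regular L \<longleftrightarrow> (\<forall>a \<in> carrier L. \<exists>A \<subseteq> Coz L. a = \<Squnion>\<^bsub>L\<^esub>A)"

definition perfectly_regular :: "('a, 'b) gorder_scheme \<Rightarrow> bool" where
  "perfectly_regular L \<longleftrightarrow>
     (\<forall>a \<in> carrier L. \<exists>A \<subseteq> Coz L. a = \<Squnion>\<^bsub>L\<^esub>A) \<and>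
     (\<forall>a \<in> carrier L. \<exists>A \<subseteq> Coz L. a = \<Sqinter>\<^bsub>L\<^esub>A)"

definition heyting_imp :: "('a, 'b) gorder_scheme \<Rightarrow> 'a \<Rightarrow> 'a \<Rightarrow> 'a" where
  "heyting_imp L x y = \<Squnion>\<^bsub>L\<^esub>{z \<in> carrier L. z \<sqinter>\<^bsub>L\<^esub> x \<sqsubseteq>\<^bsub>L\<^esub> y}"

definition is_sublocale :: "('a, 'b) gorder_scheme \<Rightarrow> 'a set \<Rightarrow> bool" where
  "is_sublocale L S \<longleftrightarrow>
     S \<subseteq> carrier L \<and>
     (\<forall>A \<subseteq> S. \<Sqinter>\<^bsub>L\<^esub>A \<in> S) \<and>
     (\<forall>x \<in> carrier L. \<forall>s \<in> S. heyting_imp L x s \<in> S)"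

text \<open>A sublocale \<open>S\<close>, regarded as a frame with the induced order, is the structure
  \<open>L\<lparr>carrier := S\<rparr>\<close>. Its meets are those of \<open>L\<close>, its joins in general are not.\<close>

abbreviation induced :: "('a, 'b) gorder_scheme \<Rightarrow> 'a set \<Rightarrow> ('a, 'b) gorder_scheme" where
  "induced L S \<equiv> L\<lparr>carrier := S\<rparr>"

definition dense_sublocale :: "('a, 'b) gorder_scheme \<Rightarrow> 'a set \<Rightarrow> bool" where
  "dense_sublocale L S \<longleftrightarrow> is_sublocale L S \<and> \<bottom>\<^bsub>L\<^esub> \<in> S"

text \<open>This inclusion characterises well-embeddedness only when \<open>S\<close> is a dense sublocale
  of a completely regular frame.\<close>

definition well_embedded :: "('a, 'b) gorder_scheme \<Rightarrow> 'a set \<Rightarrow> bool" where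
  "well_embedded L S \<longleftrightarrow> Coz L \<subseteq> Coz (induced L S)"

lemma opens_simps [simp]:
  "carrier (opens T) = {U. openin T U}" "eq (opens T) = (=)" "le (opens T) = (\<subseteq>)"
  by (simp_all add: opens_def)

lemma frame_opens: "frame (opens T)"
proof -
  interpret partial_order "opens T"
    by unfold_locales auto
  interpret complete_lattice "opens T"
  proof (rule complete_latticeI)
    fix A assume A: "A \<subseteq> carrier (opens T)"
    then have "is_lub (opens T) (\<Union>A) A"
      by (auto simp: least_def Upper_def)
    then show "\<exists>s. is_lub (opens T) s A" ..
    let ?I = "\<Union>{U. openin T U \<and> (\<forall>V\<in>A. U \<subseteq> V)}"
    have open_I: "openin T ?I"
      by auto
    have "is_glb (opens T) ?I A"
    proof (rule greatest_LowerI)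
      show "\<And>V. V \<in> A \<Longrightarrow> ?I \<sqsubseteq>\<^bsub>opens T\<^esub> V"
        by auto
      show "\<And>W. W \<in> Lower (opens T) A \<Longrightarrow> W \<sqsubseteq>\<^bsub>opens T\<^esub> ?I"
        using A by (simp add: Lower_def) blast
    qed (use A open_I in simp_all)
    then show "\<exists>i. is_glb (opens T) i A" ..
  qed
  have sup: "\<Squnion>\<^bsub>opens T\<^esub>A = \<Union>A" if "A \<subseteq> carrier (opens T)" for A
  proof (rule least_unique[OF sup_lub[OF that]])
    show "is_lub (opens T) (\<Union>A) A"
      using that by (auto simp: least_def Upper_def)
  qed
  have meet: "U \<sqinter>\<^bsub>opens T\<^esub> V = U \<inter> V" if "openin T U" "openin T V" for U V
    unfolding meet_def
  proof (rule greatest_unique[OF inf_glb])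
    show "is_glb (opens T) (U \<inter> V) {U, V}"
      using that by (auto simp: greatest_def Lower_def)
  qed (use that in auto)
  show ?thesis
  proof unfold_locales
    fix U B assume U: "U \<in> carrier (opens T)" and B: "B \<subseteq> carrier (opens T)"
    have *: "(\<lambda>V. U \<sqinter>\<^bsub>opens T\<^esub> V) ` B = (\<inter>) U ` B"
      using U B by (intro image_cong) (auto simp: meet)
    have "\<Squnion>\<^bsub>opens T\<^esub>((\<inter>) U ` B) = \<Union>((\<inter>) U ` B)"
      using U B by (intro sup) auto
    moreover have "U \<sqinter>\<^bsub>opens T\<^esub> \<Union>B = U \<inter> \<Union>B"
      using U B by (intro meet) auto
    ultimately show "U \<sqinter>\<^bsub>opens T\<^esub> \<Squnion>\<^bsub>opens T\<^esub>B = \<Squnion>\<^bsub>opens T\<^esub>((\<lambda>V. U \<sqinter>\<^bsub>opens T\<^esub> V) ` B)"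
      using * sup[OF B] by auto
  qed
qed

lemma (in frame) le_heyting_imp_iff:
  assumes z: "z \<in> carrier L" and x: "x \<in> carrier L" and y: "y \<in> carrier L"
  shows "z \<sqsubseteq> heyting_imp L x y \<longleftrightarrow> z \<sqinter> x \<sqsubseteq> y"
proof
  let ?B = "{w \<in> carrier L. w \<sqinter> x \<sqsubseteq> y}"
  have B: "?B \<subseteq> carrier L" by auto
  show "z \<sqsubseteq> heyting_imp L x y" if "z \<sqinter> x \<sqsubseteq> y"
    unfolding heyting_imp_def by (rule sup_upper[OF B]) (use that z in simp)
  assume le: "z \<sqsubseteq> heyting_imp L x y"
  have img: "(\<lambda>w. x \<sqinter> w) ` ?B \<subseteq> carrier L"
    using x by auto
  have "x \<sqinter> \<Squnion>?B = \<Squnion>((\<lambda>w. x \<sqinter> w) ` ?B)"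
    by (rule meet_sup_distrib[OF x B])
  also have "\<dots> \<sqsubseteq> y"
    by (rule sup_least[OF img y]) (use x in \<open>auto simp: meet_comm\<close>)
  finally have *: "x \<sqinter> \<Squnion>?B \<sqsubseteq> y" .
  have sB: "\<Squnion>?B \<in> carrier L"
    using B by (rule sup_closed)
  have "z \<sqinter> x \<sqsubseteq> x \<sqinter> \<Squnion>?B"
  proof (rule meet_le)
    show "z \<sqinter> x \<sqsubseteq> x"
      using z x by (rule meet_right)
    have "z \<sqinter> x \<sqsubseteq> z"
      using z x by (rule meet_left)
    then show "z \<sqinter> x \<sqsubseteq> \<Squnion>?B"
      using le z x sB unfolding heyting_imp_def by (meson le_trans meet_closed)
  qed (use z x sB in auto)
  with * show "z \<sqinter> x \<sqsubseteq> y"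
    using z x y sB by (meson le_trans meet_closed)
qed

lemma (in frame) frame_induced:
  assumes S: "is_sublocale L S"
  shows "frame (induced L S)"
proof -
  let ?S = "induced L S"
  have SL: "S \<subseteq> carrier L" and S_inf: "\<And>A. A \<subseteq> S \<Longrightarrow> \<Sqinter>A \<in> S"
    and S_imp: "\<And>x s. \<lbrakk>x \<in> carrier L; s \<in> S\<rbrakk> \<Longrightarrow> heyting_imp L x s \<in> S"
    using S by (auto simp: is_sublocale_def)
  interpret S: partial_order ?S
    by unfold_locales (use SL in \<open>auto simp: eq_is_equal intro: le_trans le_antisym\<close>)
  have glb: "is_glb ?S (\<Sqinter>A) A" if "A \<subseteq> S" for A
  proof (rule greatest_LowerI)
    show "\<And>x. x \<in> A \<Longrightarrow> \<Sqinter>A \<sqsubseteq>\<^bsub>?S\<^esub> x"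
      using that SL by (auto intro: inf_lower)
    show "y \<sqsubseteq>\<^bsub>?S\<^esub> \<Sqinter>A" if "y \<in> Lower ?S A" for y
    proof -
      have "y \<in> carrier L" "\<And>x. x \<in> A \<Longrightarrow> y \<sqsubseteq> x"
        using that \<open>A \<subseteq> S\<close> SL by (auto simp: Lower_def)
      then show ?thesis
        using inf_greatest[of A y] \<open>A \<subseteq> S\<close> SL by auto
    qed
  qed (use that S_inf in auto)
  interpret S: complete_lattice ?S
  proof (rule S.complete_lattice_criterion1)
    have "greatest ?S (\<Sqinter>{}) (carrier ?S)"
      using glb[of "{}"] by (simp add: greatest_def Lower_def)
    then show "\<exists>g. greatest ?S g (carrier ?S)" ..
    show "\<And>A. A \<subseteq> carrier ?S \<Longrightarrow> \<exists>i. is_glb ?S i A"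
      using glb by auto
  qed
  have inf_eq: "\<Sqinter>\<^bsub>?S\<^esub>A = \<Sqinter>A" if "A \<subseteq> S" for A
    by (rule S.greatest_unique[OF S.inf_glb glb]) (use that in auto)
  have meet_eq: "a \<sqinter>\<^bsub>?S\<^esub> b = a \<sqinter> b" if "a \<in> S" "b \<in> S" for a b
    unfolding meet_def using that by (intro inf_eq) auto
  show ?thesis
  proof unfold_locales
    fix a B assume a: "a \<in> carrier ?S" and B: "B \<subseteq> carrier ?S"
    let ?C = "(\<lambda>b. a \<sqinter>\<^bsub>?S\<^esub> b) ` B"
    have C: "?C \<subseteq> carrier ?S"
      using a B S.meet_closed by blast
    have t: "\<Squnion>\<^bsub>?S\<^esub>?C \<in> carrier ?S" and sB: "\<Squnion>\<^bsub>?S\<^esub>B \<in> carrier ?S"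
      using C B S.sup_closed by blast+
    have aL: "a \<in> carrier L" and tL: "\<Squnion>\<^bsub>?S\<^esub>?C \<in> carrier L" and sBL: "\<Squnion>\<^bsub>?S\<^esub>B \<in> carrier L"
      using a t sB SL by auto
    have "\<Squnion>\<^bsub>?S\<^esub>B \<sqsubseteq>\<^bsub>?S\<^esub> heyting_imp L a (\<Squnion>\<^bsub>?S\<^esub>?C)"
    proof (rule S.sup_least[OF B])
      show "heyting_imp L a (\<Squnion>\<^bsub>?S\<^esub>?C) \<in> carrier ?S"
        using S_imp aL t by simp
      fix b assume b: "b \<in> B"
      then have bS: "b \<in> S" and bL: "b \<in> carrier L"
        using B SL by auto
      have "a \<sqinter>\<^bsub>?S\<^esub> b \<sqsubseteq>\<^bsub>?S\<^esub> \<Squnion>\<^bsub>?S\<^esub>?C"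
        by (rule S.sup_upper[OF C]) (use b in auto)
      then have "b \<sqinter> a \<sqsubseteq> \<Squnion>\<^bsub>?S\<^esub>?C"
        using meet_eq[of a b] a bS by (simp add: meet_comm)
      then show "b \<sqsubseteq>\<^bsub>?S\<^esub> heyting_imp L a (\<Squnion>\<^bsub>?S\<^esub>?C)"
        using le_heyting_imp_iff[OF bL aL tL] by simp
    qed
    then have "\<Squnion>\<^bsub>?S\<^esub>B \<sqinter> a \<sqsubseteq> \<Squnion>\<^bsub>?S\<^esub>?C"
      using le_heyting_imp_iff[OF sBL aL tL] by simp
    then have 1: "a \<sqinter>\<^bsub>?S\<^esub> \<Squnion>\<^bsub>?S\<^esub>B \<sqsubseteq>\<^bsub>?S\<^esub> \<Squnion>\<^bsub>?S\<^esub>?C"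
      using meet_eq[of a "\<Squnion>\<^bsub>?S\<^esub>B"] a sB by (simp add: meet_comm)
    have 2: "\<Squnion>\<^bsub>?S\<^esub>?C \<sqsubseteq>\<^bsub>?S\<^esub> a \<sqinter>\<^bsub>?S\<^esub> \<Squnion>\<^bsub>?S\<^esub>B"
    proof (rule S.sup_least[OF C])
      show "a \<sqinter>\<^bsub>?S\<^esub> \<Squnion>\<^bsub>?S\<^esub>B \<in> carrier ?S"
        using a sB by (rule S.meet_closed)
      fix c assume "c \<in> ?C"
      then obtain b where b: "b \<in> B" and c: "c = a \<sqinter>\<^bsub>?S\<^esub> b" by auto
      have bS: "b \<in> carrier ?S" using b B by auto
      have cS: "c \<in> carrier ?S" using \<open>c \<in> ?C\<close> C by blast
      show "c \<sqsubseteq>\<^bsub>?S\<^esub> a \<sqinter>\<^bsub>?S\<^esub> \<Squnion>\<^bsub>?S\<^esub>B"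
      proof (rule S.meet_le[OF _ _ a sB cS])
        show "c \<sqsubseteq>\<^bsub>?S\<^esub> a"
          unfolding c by (rule S.meet_left[OF a bS])
        show "c \<sqsubseteq>\<^bsub>?S\<^esub> \<Squnion>\<^bsub>?S\<^esub>B"
          unfolding c
          by (rule S.le_trans[OF S.meet_right[OF a bS] S.sup_upper[OF B b] _ bS sB])
            (rule S.meet_closed[OF a bS])
      qed
    qed
    show "a \<sqinter>\<^bsub>?S\<^esub> \<Squnion>\<^bsub>?S\<^esub>B = \<Squnion>\<^bsub>?S\<^esub>?C"
      using 1 2 S.meet_closed[OF a sB] t by (rule S.le_antisym)
  qed
qed

end

theory Submission
  imports Defs "HOL-Analysis.Elementary_Normed_Spaces"
begin

text \<open>
  If \<open>S\<close> is well-embedded, then \<open>S\<close> contains \<open>Coz L\<close>, hence every meet of cozero elements; so in a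
  perfectly regular frame \<open>S = L\<close>. Conversely, let \<open>M\<close> be the set of all meets of cozero elements.
  Writing \<open>d = h (\<real> - {0})\<close> one has \<open>d \<rightarrow> c = \<Sqinter>\<^sub>\<epsilon> (h (-\<epsilon>, \<epsilon>) \<squnion> c)\<close>, and for cozero \<open>c\<close> each
  \<open>h (-\<epsilon>, \<epsilon>) \<squnion> c\<close> is a cozero element. Since every element is a join of cozero elements, \<open>M\<close> is a
  sublocale. It is dense, and composing a homomorphism into \<open>L\<close> with the nucleus
  \<open>x \<mapsto> \<Sqinter>{s \<in> M. x \<le> s}\<close> shows that it is well-embedded. So \<open>M = L\<close> if there is no proper such
  sublocale.

  \<open>Coz L\<close> is closed under binary joins because two homomorphisms \<open>h, k\<close> combine to one on the opens of
  the plane, which can be precomposed with the preimage map of \<open>\<lambda>(x, y). \<bar>x\<bar> + \<bar>y\<bar>\<close>.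
\<close>

section \<open>Composition of homomorphisms, and the lattice operations of open sets\<close>

lemma frame_hom_compose:
  assumes "frame_hom K M h" and "frame_hom M L k"
  shows "frame_hom K L (k \<circ> h)"
proof -
  have h: "h ` A \<subseteq> carrier M" if "A \<subseteq> carrier K" for A
    using assms(1) that by (auto simp: frame_hom_def)
  show ?thesis
    using assms h by (auto simp: frame_hom_def sup_pres_def meet_pres_def Pi_iff image_image)
qed

sublocale frame \<subseteq> bounded_lattice ..

text \<open>This exhausts an open set by balls whose closed balls stay inside it. In a Heine-Borel
  space these closed balls are compact, which reduces \<open>hom_meet_le_sup_product_hom\<close> to
  the compact case.\<close>

lemma Union_balls_open:
  fixes U :: "'z::metric_space set"
  assumes op: "open U"
  shows "\<Union>{ball x r |x r. cball x r \<subseteq> U} = U"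
proof
  show "\<Union>{ball x r |x r. cball x r \<subseteq> U} \<subseteq> U"
  proof (rule Union_least)
    fix B assume "B \<in> {ball x r |x r. cball x r \<subseteq> U}"
    then obtain x r where "B = ball x r" "cball x r \<subseteq> U" by blast
    then show "B \<subseteq> U"
      using ball_subset_cball[of x r] by (metis order_trans)
  qed
  show "U \<subseteq> \<Union>{ball x r |x r. cball x r \<subseteq> U}"
  proof
    fix x assume "x \<in> U"
    then obtain r where "r > 0" "cball x r \<subseteq> U"
      using op by (metis open_contains_cball)
    moreover from this have "x \<in> ball x r" by simp
    ultimately show "x \<in> \<Union>{ball x r |x r. cball x r \<subseteq> U}" by blast
  qed
qed

lemma opens_operations:
  shows sup_opens: "\<And>A. (\<And>U. U \<in> A \<Longrightarrow> openin T U) \<Longrightarrow> \<Squnion>\<^bsub>opens T\<^esub>A = \<Union>A"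
    and meet_opens: "\<And>U V. \<lbrakk>openin T U; openin T V\<rbrakk> \<Longrightarrow> U \<sqinter>\<^bsub>opens T\<^esub> V = U \<inter> V"
    and top_opens: "\<top>\<^bsub>opens T\<^esub> = topspace T"
proof -
  interpret T: frame "opens T" by (rule frame_opens)
  show "\<Squnion>\<^bsub>opens T\<^esub>A = \<Union>A" if A: "\<And>U. U \<in> A \<Longrightarrow> openin T U" for A
  proof (rule T.least_unique[OF T.sup_lub])
    show "is_lub (opens T) (\<Union>A) A"
      using A by (auto simp: least_def Upper_def)
  qed (use A in auto)
  show "U \<sqinter>\<^bsub>opens T\<^esub> V = U \<inter> V" if "openin T U" "openin T V" for U V
    unfolding meet_def
  proof (rule T.greatest_unique[OF T.inf_glb])
    show "is_glb (opens T) (U \<inter> V) {U, V}"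
      using that by (auto simp: greatest_def Lower_def)
  qed (use that in auto)
  show "\<top>\<^bsub>opens T\<^esub> = topspace T"
    by (rule T.top_eq[symmetric]) (auto simp: openin_subset)
qed

section \<open>Inequalities from the frame law\<close>

context frame
begin

text \<open>Meeting with \<open>b\<close> has the right adjoint \<open>heyting_imp L b\<close>, so
  the claim becomes \<open>\<Squnion>A \<sqsubseteq> heyting_imp L b z\<close>, which is checked on
  the members of \<open>A\<close>. Most later uses of distributivity take this form.\<close>

lemma sup_meet_le:
  assumes A: "A \<subseteq> carrier L" and b: "b \<in> carrier L" and z: "z \<in> carrier L"
    and le: "\<And>a. a \<in> A \<Longrightarrow> a \<sqinter> b \<sqsubseteq> z"
  shows "\<Squnion>A \<sqinter> b \<sqsubseteq> z"
proof -
  have imp: "heyting_imp L b z \<in> carrier L"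
    by (simp add: heyting_imp_def)
  have "\<Squnion>A \<sqsubseteq> heyting_imp L b z"
  proof (rule sup_least[OF A imp])
    fix a assume "a \<in> A"
    then show "a \<sqsubseteq> heyting_imp L b z"
      using le A b z by (subst le_heyting_imp_iff) auto
  qed
  then show ?thesis
    using le_heyting_imp_iff[OF sup_closed[OF A] b z] by simp
qed

lemma sup_meet_sup_le:
  assumes A: "A \<subseteq> carrier L" and B: "B \<subseteq> carrier L" and z: "z \<in> carrier L"
    and le: "\<And>a b. \<lbrakk>a \<in> A; b \<in> B\<rbrakk> \<Longrightarrow> a \<sqinter> b \<sqsubseteq> z"
  shows "\<Squnion>A \<sqinter> \<Squnion>B \<sqsubseteq> z"
proof (rule sup_meet_le[OF A sup_closed[OF B] z])
  fix a assume a: "a \<in> A"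
  have "\<Squnion>B \<sqinter> a \<sqsubseteq> z"
    by (rule sup_meet_le[OF B _ z]) (use a A le in \<open>auto simp: meet_comm[of L _ a]\<close>)
  then show "a \<sqinter> \<Squnion>B \<sqsubseteq> z"
    by (simp add: meet_comm)
qed

lemma meet_mono:
  assumes "a \<sqsubseteq> c" "b \<sqsubseteq> d" "a \<in> carrier L" "b \<in> carrier L" "c \<in> carrier L" "d \<in> carrier L"
  shows "a \<sqinter> b \<sqsubseteq> c \<sqinter> d"
  by (rule meet_le)
    (use assms in \<open>auto intro: le_trans[OF meet_left] le_trans[OF meet_right]\<close>)

lemma meet_meet_swap:
  assumes "a \<in> carrier L" "b \<in> carrier L" "c \<in> carrier L" "d \<in> carrier L"
  shows "(a \<sqinter> b) \<sqinter> (c \<sqinter> d) = (a \<sqinter> c) \<sqinter> (b \<sqinter> d)"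
proof -
  have "(a \<sqinter> b) \<sqinter> (c \<sqinter> d) = a \<sqinter> ((b \<sqinter> c) \<sqinter> d)"
    using assms by (simp add: meet_assoc)
  also have "\<dots> = (a \<sqinter> c) \<sqinter> (b \<sqinter> d)"
    using assms by (simp add: meet_assoc meet_comm[of L b c])
  finally show ?thesis .
qed

lemma meet_left_mono:
  assumes "a \<in> carrier L" "b \<in> carrier L" "c \<in> carrier L" "a \<sqsubseteq> c"
  shows "a \<sqinter> b \<sqsubseteq> c"
  using assms by (auto intro: le_trans[OF meet_left])

section \<open>Homomorphisms defined on open sets\<close>

lemma frame_hom_opens_iff:
  "frame_hom (opens T) L h \<longleftrightarrow>
    (\<forall>U. openin T U \<longrightarrow> h U \<in> carrier L) \<and>
    (\<forall>\<U>. (\<forall>U\<in>\<U>. openin T U) \<longrightarrow> h (\<Union>\<U>) = \<Squnion>(h ` \<U>)) \<and>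
    (\<forall>U V. openin T U \<longrightarrow> openin T V \<longrightarrow> h (U \<inter> V) = h U \<sqinter> h V) \<and>
    h (topspace T) = \<top>"
proof -
  interpret T: frame "opens T" by (rule frame_opens)
  \<comment> \<open>\<open>sup_pres\<close> and \<open>meet_pres\<close> contain these lattice
    claims as conjuncts.\<close>
  have "complete_lattice (opens T)" "complete_lattice L" "lattice (opens T)" "lattice L"
    by unfold_locales
  then show ?thesis
    unfolding frame_hom_def sup_pres_def meet_pres_def
    by (auto simp: sup_opens meet_opens top_opens subset_iff)
qed

lemma frame_hom_opens_mono:
  assumes h: "frame_hom (opens T) L h" and U: "openin T U" and V: "openin T V" and "U \<subseteq> V"
  shows "h U \<sqsubseteq> h V"
proof -
  have "h U = h U \<sqinter> h V"
    using h U V Int_absorb2[OF \<open>U \<subseteq> V\<close>] unfolding frame_hom_opens_iff by metis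
  then show ?thesis
    using h U V unfolding frame_hom_opens_iff by (metis meet_right)
qed

lemma frame_hom_opens_closed: "\<lbrakk>frame_hom (opens T) L h; openin T U\<rbrakk> \<Longrightarrow> h U \<in> carrier L"
  by (simp add: frame_hom_opens_iff)

lemma frame_hom_opens_Union:
  assumes h: "frame_hom (opens T) L h" and "\<And>U. U \<in> \<U> \<Longrightarrow> openin T U"
  shows "h (\<Union>\<U>) = \<Squnion>(h ` \<U>)"
proof -
  have "\<forall>U\<in>\<U>. openin T U"
    using assms(2) by simp
  then show ?thesis
    using h unfolding frame_hom_opens_iff by simp
qed

lemma frame_hom_opens_empty:
  assumes "frame_hom (opens T) L h"
  shows "h {} = \<bottom>"
proof -
  have "h (\<Union>{}) = \<Squnion>(h ` {})"
    by (rule frame_hom_opens_Union[OF assms]) simp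
  then show ?thesis
    using weak_sup_empty by (simp add: eq_is_equal)
qed

lemma frame_hom_opens_Un:
  assumes h: "frame_hom (opens T) L h" and UV: "openin T U" "openin T V"
  shows "h (U \<union> V) = h U \<squnion> h V"
proof -
  have "h (\<Union>{U, V}) = \<Squnion>(h ` {U, V})"
    by (rule frame_hom_opens_Union[OF h]) (use UV in auto)
  then show ?thesis
    by (simp add: join_def)
qed

text \<open>Preimages under a continuous map commute with unions and intersections. In this way a
  homomorphism on the opens of the plane yields one on the opens of the line.\<close>

lemma frame_hom_preimage:
  assumes h: "frame_hom (opens T) L h" and f: "continuous_map T T' f"
  shows "frame_hom (opens T') L (\<lambda>U. h {x \<in> topspace T. f x \<in> U})"
proof -
  have open_pre: "openin T {x \<in> topspace T. f x \<in> U}" if "openin T' U" for U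
    using f that by (simp add: continuous_map_def)
  have Un: "{x \<in> topspace T. f x \<in> \<Union>\<U>} = \<Union>((\<lambda>U. {x \<in> topspace T. f x \<in> U}) ` \<U>)" for \<U>
    by auto
  have Int: "{x \<in> topspace T. f x \<in> U \<inter> V} =
      {x \<in> topspace T. f x \<in> U} \<inter> {x \<in> topspace T. f x \<in> V}" for U V
    by auto
  have top: "{x \<in> topspace T. f x \<in> topspace T'} = topspace T"
    using f by (auto simp: continuous_map_def)
  have sup: "h (\<Union>((\<lambda>U. {x \<in> topspace T. f x \<in> U}) ` \<U>)) =
      \<Squnion>(h ` (\<lambda>U. {x \<in> topspace T. f x \<in> U}) ` \<U>)" if "\<forall>U\<in>\<U>. openin T' U" for \<U>
    by (rule frame_hom_opens_Union[OF h]) (use that open_pre in auto)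
  show ?thesis
    using h open_pre sup unfolding frame_hom_opens_iff Un Int top
    by (simp add: image_image)
qed

end

section \<open>Copairing: the homomorphism on the opens of a product induced by two
  homomorphisms\<close>

definition product_hom ::
    "('a, 'b) gorder_scheme \<Rightarrow> ('x::topological_space set \<Rightarrow> 'a) \<Rightarrow>
      ('y::topological_space set \<Rightarrow> 'a) \<Rightarrow> ('x \<times> 'y) set \<Rightarrow> 'a" where
  "product_hom L h k G =
    \<Squnion>\<^bsub>L\<^esub>{h V \<sqinter>\<^bsub>L\<^esub> k W |V W. open V \<and> open W \<and> V \<times> W \<subseteq> G}"

context frame
begin

context
  fixes h :: "'x::heine_borel set \<Rightarrow> 'a" and k :: "'y::heine_borel set \<Rightarrow> 'a"
  assumes h: "frame_hom (opens euclidean) L h" and k: "frame_hom (opens euclidean) L k"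
begin

lemma hom_carrier [simp]:
  "open V \<Longrightarrow> h V \<in> carrier L" "open W \<Longrightarrow> k W \<in> carrier L"
  using h k by (simp_all add: frame_hom_opens_iff)

lemma product_hom_carrier [simp]: "product_hom L h k G \<in> carrier L"
  unfolding product_hom_def by (rule sup_closed) auto

lemma product_hom_upper:
  assumes "open V" "open W" "V \<times> W \<subseteq> G"
  shows "h V \<sqinter> k W \<sqsubseteq> product_hom L h k G"
  unfolding product_hom_def by (rule sup_upper) (use assms in auto)

lemma product_hom_least:
  assumes "z \<in> carrier L" "\<And>V W. \<lbrakk>open V; open W; V \<times> W \<subseteq> G\<rbrakk> \<Longrightarrow> h V \<sqinter> k W \<sqsubseteq> z"
  shows "product_hom L h k G \<sqsubseteq> z"
  unfolding product_hom_def by (rule sup_least) (use assms in auto)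

lemma product_hom_mono:
  assumes "G \<subseteq> G'"
  shows "product_hom L h k G \<sqsubseteq> product_hom L h k G'"
  by (rule product_hom_least) (use assms in \<open>auto intro: product_hom_upper\<close>)

text \<open>Localisation: \<open>h\<close> and \<open>k\<close> turn unions into joins, and binary
  meets distribute over joins, so a bound on a box can be checked on the pieces of covers of its two
  sides. It is applied below with small balls, and then with balls whose closed balls lie inside the
  given sides.\<close>

lemma hom_meet_le_by_covers:
  assumes "\<And>V. V \<in> \<V> \<Longrightarrow> open V" and "\<And>W. W \<in> \<W> \<Longrightarrow> open W" and z: "z \<in> carrier L"
    and le: "\<And>V W. \<lbrakk>V \<in> \<V>; W \<in> \<W>\<rbrakk> \<Longrightarrow> h V \<sqinter> k W \<sqsubseteq> z"
  shows "h (\<Union>\<V>) \<sqinter> k (\<Union>\<W>) \<sqsubseteq> z"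
proof -
  have "h (\<Union>\<V>) = \<Squnion>(h ` \<V>)" "k (\<Union>\<W>) = \<Squnion>(k ` \<W>)"
    using assms(1,2) by (auto intro!: frame_hom_opens_Union[OF h] frame_hom_opens_Union[OF k])
  moreover have "\<Squnion>(h ` \<V>) \<sqinter> \<Squnion>(k ` \<W>) \<sqsubseteq> z"
    by (rule sup_meet_sup_le) (use assms in auto)
  ultimately show ?thesis
    by simp
qed

text \<open>By the Lebesgue number lemma, sufficiently small boxes lie in a single member of the cover.\<close>

lemma hom_meet_le_sup_product_hom_compact:
  assumes V: "open V" "V \<subseteq> K" "compact K" and W: "open W" "W \<subseteq> C" "compact C"
    and \<G>: "\<And>G. G \<in> \<G> \<Longrightarrow> open G" and sub: "K \<times> C \<subseteq> \<Union>\<G>"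
  shows "h V \<sqinter> k W \<sqsubseteq> \<Squnion>(product_hom L h k ` \<G>)"
proof -
  let ?s = "\<Squnion>(product_hom L h k ` \<G>)"
  have PG: "product_hom L h k ` \<G> \<subseteq> carrier L" by auto
  obtain \<epsilon> where \<epsilon>: "\<epsilon> > 0" and small: "\<And>p. p \<in> K \<times> C \<Longrightarrow> \<exists>G\<in>\<G>. ball p \<epsilon> \<subseteq> G"
    using Heine_Borel_lemma[OF compact_Times[OF \<open>compact K\<close> \<open>compact C\<close>] sub \<G>] by metis
  \<comment> \<open>In the product metric, the product of two balls of radius
    \<open>\<epsilon>/2\<close> lies in the ball of radius \<open>\<epsilon>\<close> around the pair
    of centres. Intersecting with \<open>V\<close> and \<open>W\<close> makes the two covers
    exact.\<close>
  let ?\<V> = "(\<lambda>x. V \<inter> ball x (\<epsilon>/2)) ` V" and ?\<W> = "(\<lambda>y. W \<inter> ball y (\<epsilon>/2)) ` W"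
  have "h (\<Union>?\<V>) \<sqinter> k (\<Union>?\<W>) \<sqsubseteq> ?s"
  proof (rule hom_meet_le_by_covers)
    fix V' W' assume "V' \<in> ?\<V>" "W' \<in> ?\<W>"
    then obtain x y where xy: "x \<in> V" "y \<in> W"
      and V': "V' = V \<inter> ball x (\<epsilon>/2)" and W': "W' = W \<inter> ball y (\<epsilon>/2)" by blast
    obtain G where G: "G \<in> \<G>" "ball (x, y) \<epsilon> \<subseteq> G"
      using small[of "(x, y)"] xy V W by auto
    have "V' \<times> W' \<subseteq> ball (x, y) \<epsilon>"
      by (auto simp: V' W' dist_Pair_Pair intro!: sqrt_sum_squares_half_less)
    then have "h V' \<sqinter> k W' \<sqsubseteq> product_hom L h k G"
      using G V W by (intro product_hom_upper) (auto simp: V' W')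
    moreover have "product_hom L h k G \<sqsubseteq> ?s"
      using G by (intro sup_upper[OF PG]) auto
    ultimately show "h V' \<sqinter> k W' \<sqsubseteq> ?s"
      by (rule le_trans) (use V W PG in \<open>auto simp: V' W' open_Int\<close>)
  qed (use V W PG in auto)
  moreover have "\<Union>?\<V> = V" "\<Union>?\<W> = W"
    using \<epsilon> by auto
  ultimately show ?thesis by simp
qed

text \<open>The sides of the box are exhausted by balls whose closed balls lie in them. The product
  of two such closed balls is a compact box inside the union, so the compact case applies to each
  pair.\<close>

lemma hom_meet_le_sup_product_hom:
  assumes V: "open V" and W: "open W"
    and \<G>: "\<And>G. G \<in> \<G> \<Longrightarrow> open G" and sub: "V \<times> W \<subseteq> \<Union>\<G>"
  shows "h V \<sqinter> k W \<sqsubseteq> \<Squnion>(product_hom L h k ` \<G>)"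
proof -
  let ?\<V> = "{ball x r |x r. cball x r \<subseteq> V}" and ?\<W> = "{ball y r |y r. cball y r \<subseteq> W}"
  have "h (\<Union>?\<V>) \<sqinter> k (\<Union>?\<W>) \<sqsubseteq> \<Squnion>(product_hom L h k ` \<G>)"
  proof (rule hom_meet_le_by_covers)
    fix V' W' assume "V' \<in> ?\<V>" "W' \<in> ?\<W>"
    then obtain x r y s where "V' = ball x r" "W' = ball y s" "cball x r \<subseteq> V" "cball y s \<subseteq> W"
      by blast
    moreover from this have "cball x r \<times> cball y s \<subseteq> \<Union>\<G>"
      using sub by blast
    ultimately show "h V' \<sqinter> k W' \<sqsubseteq> \<Squnion>(product_hom L h k ` \<G>)"
      using \<G>
      by (intro hom_meet_le_sup_product_hom_compact[where K = "cball x r" and C = "cball y s"]) auto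
  qed (auto intro: sup_closed)
  then show ?thesis
    using V W by (simp add: Union_balls_open)
qed

text \<open>Preservation of joins is the substantial point and rests on the compactness argument
  above. For binary meets, distributivity reduces the claim to two boxes, whose intersection is
  again a box.\<close>

lemma frame_hom_product_hom: "frame_hom (opens euclidean) L (product_hom L h k)"
  unfolding frame_hom_opens_iff
proof (intro conjI allI impI)
  let ?P = "product_hom L h k"
  show "?P U \<in> carrier L" for U by simp
  show "?P (\<Union>\<U>) = \<Squnion>(?P ` \<U>)" if "\<forall>U\<in>\<U>. openin euclidean U" for \<U>
  proof (rule le_antisym)
    have c: "?P ` \<U> \<subseteq> carrier L" by auto
    show "?P (\<Union>\<U>) \<sqsubseteq> \<Squnion>(?P ` \<U>)"
      using that c by (intro product_hom_least hom_meet_le_sup_product_hom) auto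
    show "\<Squnion>(?P ` \<U>) \<sqsubseteq> ?P (\<Union>\<U>)"
      by (rule sup_least[OF c]) (auto intro!: product_hom_mono)
  qed (auto intro!: sup_closed)
  show "?P (G \<inter> G') = ?P G \<sqinter> ?P G'" for G G'
  proof (rule le_antisym)
    show "?P (G \<inter> G') \<sqsubseteq> ?P G \<sqinter> ?P G'"
      by (intro meet_le product_hom_mono) auto
    show "?P G \<sqinter> ?P G' \<sqsubseteq> ?P (G \<inter> G')"
      unfolding product_hom_def[of L h k G] product_hom_def[of L h k G']
    proof (rule sup_meet_sup_le)
      fix a b
      assume "a \<in> {h V \<sqinter> k W |V W. open V \<and> open W \<and> V \<times> W \<subseteq> G}"
        and "b \<in> {h V \<sqinter> k W |V W. open V \<and> open W \<and> V \<times> W \<subseteq> G'}"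
      then obtain V W V' W' where *: "open V" "open W" "V \<times> W \<subseteq> G" "a = h V \<sqinter> k W"
          "open V'" "open W'" "V' \<times> W' \<subseteq> G'" "b = h V' \<sqinter> k W'"
        by blast
      have "a \<sqinter> b = (h V \<sqinter> h V') \<sqinter> (k W \<sqinter> k W')"
        using * by (simp add: meet_meet_swap)
      also have "\<dots> = h (V \<inter> V') \<sqinter> k (W \<inter> W')"
        using h k * by (simp add: frame_hom_opens_iff)
      also have "\<dots> \<sqsubseteq> ?P (G \<inter> G')"
        using * by (intro product_hom_upper) auto
      finally show "a \<sqinter> b \<sqsubseteq> ?P (G \<inter> G')" .
    qed auto
  qed auto
  show "?P (topspace euclidean) = \<top>"
  proof (rule top_eq)
    fix x assume x: "x \<in> carrier L"
    have "h UNIV = \<top>" "k UNIV = \<top>"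
      using h k by (simp_all add: frame_hom_opens_iff)
    then have "x \<sqsubseteq> h UNIV \<sqinter> k UNIV"
      using x by (intro meet_le) (auto intro: top_higher)
    also have "\<dots> \<sqsubseteq> ?P (topspace euclidean)"
      by (intro product_hom_upper) auto
    finally show "x \<sqsubseteq> ?P (topspace euclidean)"
      using x by simp
  qed simp
qed

text \<open>\<open>A \<times> UNIV\<close> is the preimage of \<open>A\<close> under the first
  projection, so this says that the copairing restricts to \<open>h\<close>; the next lemma does the
  same for \<open>k\<close>.\<close>

lemma product_hom_Times_UNIV:
  assumes A: "open A"
  shows "product_hom L h k (A \<times> UNIV) = h A"
proof (rule le_antisym)
  have "k UNIV = \<top>"
    using k by (simp add: frame_hom_opens_iff)
  then have "h A \<sqsubseteq> h A \<sqinter> k UNIV"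
    using A by (intro meet_le) (auto intro: top_higher)
  also have "\<dots> \<sqsubseteq> product_hom L h k (A \<times> UNIV)"
    by (rule product_hom_upper) (use A in auto)
  finally show "h A \<sqsubseteq> product_hom L h k (A \<times> UNIV)"
    using A by simp
  show "product_hom L h k (A \<times> UNIV) \<sqsubseteq> h A"
  proof (rule product_hom_least)
    fix V W assume VW: "open V" "open W" "V \<times> W \<subseteq> A \<times> (UNIV :: 'y set)"
    show "h V \<sqinter> k W \<sqsubseteq> h A"
    \<comment> \<open>The inclusion of boxes yields \<open>V \<subseteq> A\<close> only for nonempty
      \<open>W\<close>; an empty \<open>W\<close> contributes bottom, because
      \<open>k {} = \<bottom>\<close>.\<close>
    proof (cases "W = {}")
      case True
      then have "h V \<sqinter> k W \<sqsubseteq> \<bottom>"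
        using VW hom_carrier frame_hom_opens_empty[OF k] by (metis meet_right)
      then show ?thesis
        using A VW by (meson bottom_closed bottom_lower hom_carrier le_trans meet_closed)
    next
      case False
      then have "h V \<sqsubseteq> h A"
        using VW A by (intro frame_hom_opens_mono[OF h]) auto
      then show ?thesis
        using VW A by (intro meet_left_mono) auto
    qed
  qed (use A in simp)
qed (use A in auto)

lemma product_hom_UNIV_Times:
  assumes B: "open B"
  shows "product_hom L h k (UNIV \<times> B) = k B"
proof (rule le_antisym)
  have "h UNIV = \<top>"
    using h by (simp add: frame_hom_opens_iff)
  then have "k B \<sqsubseteq> h UNIV \<sqinter> k B"
    using B by (intro meet_le) (auto intro: top_higher)
  also have "\<dots> \<sqsubseteq> product_hom L h k (UNIV \<times> B)"
    by (rule product_hom_upper) (use B in auto)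
  finally show "k B \<sqsubseteq> product_hom L h k (UNIV \<times> B)"
    using B by simp
  show "product_hom L h k (UNIV \<times> B) \<sqsubseteq> k B"
  proof (rule product_hom_least)
    fix V W assume VW: "open V" "open W" "V \<times> W \<subseteq> (UNIV :: 'x set) \<times> B"
    show "h V \<sqinter> k W \<sqsubseteq> k B"
    proof (cases "V = {}")
      case True
      then have "h V \<sqinter> k W \<sqsubseteq> \<bottom>"
        using VW hom_carrier frame_hom_opens_empty[OF h] by (metis meet_left)
      then show ?thesis
        using B VW by (meson bottom_closed bottom_lower hom_carrier le_trans meet_closed)
    next
      case False
      then have "k W \<sqsubseteq> k B"
        using VW B by (intro frame_hom_opens_mono[OF k]) auto
      then have "k W \<sqinter> h V \<sqsubseteq> k B"
        using VW B by (intro meet_left_mono) auto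
      then show ?thesis
        by (simp add: meet_comm)
    qed
  qed (use B in simp)
qed (use B in auto)

end

section \<open>Cozero elements\<close>

lemma Coz_carrier: "Coz L \<subseteq> carrier L"
proof
  fix c assume "c \<in> Coz L"
  then obtain h where "frame_hom (opens (euclidean :: real topology)) L h" "c = h (UNIV - {0})"
    unfolding Coz_def by auto
  then show "c \<in> carrier L"
    unfolding frame_hom_opens_iff by (simp add: open_Diff)
qed

text \<open>Precomposing \<open>h\<close> with preimages under \<open>f\<close> gives a homomorphism
  on the opens of the line, and its value at \<open>UNIV - {0}\<close> is the element in question.
  Continuous functions thereby serve as a source of cozero elements.\<close>

lemma frame_hom_support_in_Coz:
  fixes f :: "'x::topological_space \<Rightarrow> real"
  assumes h: "frame_hom (opens euclidean) L h" and f: "continuous_on UNIV f"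
  shows "h {x. f x \<noteq> 0} \<in> Coz L"
proof -
  have "frame_hom (opens euclidean) L (\<lambda>U. h {x. f x \<in> U})"
    using frame_hom_preimage[OF h, of euclidean f] f by simp
  moreover have "{x. f x \<noteq> 0} = {x. f x \<in> UNIV - {0}}" by simp
  ultimately show ?thesis
    unfolding Coz_def by (auto intro!: exI[of _ "\<lambda>U. h {x. f x \<in> U}"])
qed

lemma join_in_Coz:
  assumes "a \<in> Coz L" "b \<in> Coz L"
  shows "a \<squnion> b \<in> Coz L"
proof -
  obtain h k where h: "frame_hom (opens (euclidean :: real topology)) L h"
    and k: "frame_hom (opens (euclidean :: real topology)) L k"
    and a: "a = h (UNIV - {0})" and b: "b = k (UNIV - {0})"
    using assms unfolding Coz_def by auto
  \<comment> \<open>\<open>?A\<close> and \<open>?B\<close> are the preimages of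
    \<open>UNIV - {0}\<close> under the two projections, so \<open>?P\<close> sends them to
    \<open>a\<close> and \<open>b\<close>.\<close>
  let ?P = "product_hom L h k" and ?A = "(UNIV - {0 :: real}) \<times> (UNIV :: real set)"
    and ?B = "(UNIV :: real set) \<times> (UNIV - {0 :: real})"
  note P = frame_hom_product_hom[OF h k]
  have op: "open (UNIV - {0 :: real})"
    by (simp add: open_Diff)
  have "open ?A" "open ?B"
    by (auto intro!: open_Times op)
  then have "?P (?A \<union> ?B) = ?P ?A \<squnion> ?P ?B"
    by (intro frame_hom_opens_Un[OF P]) simp_all
  also have "\<dots> = a \<squnion> b"
    using product_hom_Times_UNIV[OF h k op] product_hom_UNIV_Times[OF h k op] a b by simp
  also have "?A \<union> ?B = {p. \<bar>fst p\<bar> + \<bar>snd p\<bar> \<noteq> 0}"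
    by auto
  finally have "?P {p. \<bar>fst p\<bar> + \<bar>snd p\<bar> \<noteq> 0} = a \<squnion> b" .
  moreover have "?P {p. \<bar>fst p\<bar> + \<bar>snd p\<bar> \<noteq> 0} \<in> Coz L"
    by (rule frame_hom_support_in_Coz[OF P]) (intro continuous_intros)
  ultimately show ?thesis
    by simp
qed

text \<open>This homomorphism belongs to the constant map with value \<open>p\<close>. For
  \<open>p = 0\<close> on the line its value at \<open>UNIV - {0}\<close> is bottom, which makes
  bottom a cozero element.\<close>

lemma frame_hom_point:
  assumes "p \<in> topspace T"
  shows "frame_hom (opens T) L (\<lambda>U. if p \<in> U then \<top> else \<bottom>)"
  unfolding frame_hom_opens_iff
proof (intro conjI allI impI)
  let ?h = "\<lambda>U. if p \<in> U then \<top> else \<bottom>"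
  show "?h (\<Union>\<U>) = \<Squnion>(?h ` \<U>)" for \<U>
  proof (cases "p \<in> \<Union>\<U>")
    case True
    then have "\<top> \<in> ?h ` \<U>" by auto
    then have "\<top> \<sqsubseteq> \<Squnion>(?h ` \<U>)"
      by (intro sup_upper) auto
    moreover have c: "\<Squnion>(?h ` \<U>) \<in> carrier L"
      by (intro sup_closed) auto
    ultimately show ?thesis
      using True top_higher[OF c] by (auto intro!: le_antisym)
  next
    case False
    then have "?h ` \<U> = {} \<or> ?h ` \<U> = {\<bottom>}"
      by auto
    then have "\<Squnion>(?h ` \<U>) = \<bottom>"
      using weak_sup_empty sup_of_singleton[OF bottom_closed] by (metis eq_is_equal)
    then show ?thesis
      using False by (simp only: if_False)
  qed
  have "\<top> \<sqinter> x = x" "\<bottom> \<sqinter> x = \<bottom>" if "x \<in> carrier L" for x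
    using that top_meet bottom_meet by (auto simp: eq_is_equal)
  then show "?h (U \<inter> V) = ?h U \<sqinter> ?h V" for U V
    by auto
qed (use assms in auto)

lemma bottom_in_Coz: "\<bottom> \<in> Coz L"
  using frame_hom_point[of 0 "euclidean :: real topology"] unfolding Coz_def
  by (auto intro!: exI[of _ "\<lambda>U. if 0 \<in> U then \<top> else \<bottom>"])

section \<open>Meets of cozero elements\<close>

definition coz_meets :: "'a set" where
  "coz_meets = {\<Sqinter>A |A. A \<subseteq> Coz L}"

lemma Inf_Coz_in_coz_meets: "A \<subseteq> Coz L \<Longrightarrow> \<Sqinter>A \<in> coz_meets"
  unfolding coz_meets_def by (rule CollectI, rule exI[of _ A]) simp

lemma Coz_subset_coz_meets: "Coz L \<subseteq> coz_meets"
proof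
  fix c assume "c \<in> Coz L"
  then have "\<Sqinter>{c} = c" "{c} \<subseteq> Coz L"
    using Coz_carrier by auto
  then show "c \<in> coz_meets"
    using Inf_Coz_in_coz_meets[of "{c}"] by simp
qed

lemma coz_meets_carrier: "coz_meets \<subseteq> carrier L"
proof
  fix x assume "x \<in> coz_meets"
  then obtain A where "A \<subseteq> Coz L" "x = \<Sqinter>A"
    unfolding coz_meets_def by auto
  then show "x \<in> carrier L"
    using Coz_carrier by auto
qed

text \<open>Together with \<open>coz_meetsD\<close> this characterises \<open>coz_meets\<close> by a
  test: \<open>x\<close> belongs to it iff every \<open>y\<close> below all cozero elements above
  \<open>x\<close> is below \<open>x\<close>. The family used as witness is the largest possible
  one, all cozero elements above \<open>x\<close>.\<close>

lemma coz_meetsI: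
  assumes x: "x \<in> carrier L"
    and le: "\<And>y. \<lbrakk>y \<in> carrier L; \<And>c. \<lbrakk>c \<in> Coz L; x \<sqsubseteq> c\<rbrakk> \<Longrightarrow> y \<sqsubseteq> c\<rbrakk> \<Longrightarrow> y \<sqsubseteq> x"
  shows "x \<in> coz_meets"
proof -
  let ?A = "{c \<in> Coz L. x \<sqsubseteq> c}"
  have A: "?A \<subseteq> carrier L"
    using Coz_carrier by auto
  have "\<Sqinter>?A = x"
  proof (rule le_antisym)
    show "\<Sqinter>?A \<sqsubseteq> x"
      by (rule le) (use A in \<open>auto intro: inf_lower\<close>)
    show "x \<sqsubseteq> \<Sqinter>?A"
      by (rule inf_greatest) (use A x in auto)
  qed (use A x in auto)
  then show ?thesis
    using Inf_Coz_in_coz_meets[of ?A] by auto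
qed

lemma coz_meetsD:
  assumes x: "x \<in> coz_meets" and y: "y \<in> carrier L"
    and le: "\<And>c. \<lbrakk>c \<in> Coz L; x \<sqsubseteq> c\<rbrakk> \<Longrightarrow> y \<sqsubseteq> c"
  shows "y \<sqsubseteq> x"
proof -
  obtain A where A: "A \<subseteq> Coz L" and x: "x = \<Sqinter>A"
    using x unfolding coz_meets_def by blast
  then have "A \<subseteq> carrier L"
    using Coz_carrier by auto
  then show ?thesis
    unfolding x using A y by (intro inf_greatest) (auto intro!: le simp: x inf_lower)
qed

lemma heyting_imp_carrier [simp]: "heyting_imp L x y \<in> carrier L"
  unfolding heyting_imp_def by (rule sup_closed) auto

text \<open>A given \<open>y\<close> below all cozero elements above the implication is tested
  against \<open>h (ball 0 \<epsilon>) \<squnion> c\<close>. As the ball is disjoint from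
  \<open>{x. \<epsilon> < \<bar>x\<bar>}\<close>, the meet of \<open>y\<close> with the image of
  that set lies below \<open>c\<close>. These sets exhaust \<open>UNIV - {0}\<close>, so
  \<open>y \<sqinter> d \<sqsubseteq> c\<close>, and the adjunction finishes.\<close>

lemma heyting_imp_Coz:
  assumes d: "d \<in> Coz L" and c: "c \<in> Coz L"
  shows "heyting_imp L d c \<in> coz_meets"
proof (rule coz_meetsI)
  obtain h where h: "frame_hom (opens (euclidean :: real topology)) L h" and d_eq: "d = h (UNIV - {0})"
    using d unfolding Coz_def by auto
  have hc [simp]: "h U \<in> carrier L" if "open U" for U
    using frame_hom_opens_closed[OF h] that by simp
  have op: "open (UNIV - {0 :: real})"
    by (simp add: open_Diff)
  have dL [simp]: "d \<in> carrier L" and cL [simp]: "c \<in> carrier L"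
    using c d Coz_carrier by auto
  let ?i = "heyting_imp L d c"
  have imp: "?i \<sqinter> d \<sqsubseteq> c"
    using le_heyting_imp_iff[of ?i d c] by (simp add: le_refl)
  fix y assume y: "y \<in> carrier L" and le: "\<And>c. \<lbrakk>c \<in> Coz L; ?i \<sqsubseteq> c\<rbrakk> \<Longrightarrow> y \<sqsubseteq> c"
  have y_le: "y \<sqsubseteq> h (ball 0 \<epsilon>) \<squnion> c" if \<epsilon>: "\<epsilon> > 0" for \<epsilon>
  proof (rule le)
    let ?e = "h (ball 0 \<epsilon>)"
    \<comment> \<open>A tent function that is nonzero exactly on the ball.\<close>
    have "h {x. max 0 (\<epsilon> - \<bar>x\<bar>) \<noteq> 0} \<in> Coz L"
      by (rule frame_hom_support_in_Coz[OF h]) (intro continuous_intros)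
    moreover have "{x. max 0 (\<epsilon> - \<bar>x\<bar>) \<noteq> 0} = ball 0 \<epsilon>"
      by (auto simp: max_def)
    ultimately show "?e \<squnion> c \<in> Coz L"
      using c join_in_Coz by simp
    \<comment> \<open>The punctured line and the ball cover the line, so \<open>d\<close> and
      \<open>?e\<close> join to top. This splits \<open>?i\<close> into its meet with
      \<open>d\<close>, which is below \<open>c\<close>, and its meet with
      \<open>?e\<close>.\<close>
    have "h ((UNIV - {0}) \<union> ball 0 \<epsilon>) = d \<squnion> ?e"
      using op unfolding d_eq by (intro frame_hom_opens_Un[OF h]) simp_all
    moreover have "(UNIV - {0}) \<union> ball 0 \<epsilon> = topspace (euclidean :: real topology)"
      using \<epsilon> by auto
    ultimately have top: "\<Squnion>{d, ?e} = \<top>"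
      using h unfolding frame_hom_opens_iff join_def by metis
    have "\<Squnion>{d, ?e} \<sqinter> ?i \<sqsubseteq> ?e \<squnion> c"
    proof (rule sup_meet_le)
      fix a assume "a \<in> {d, ?e}"
      then consider "a = d" | "a = ?e" by blast
      then show "a \<sqinter> ?i \<sqsubseteq> ?e \<squnion> c"
      proof cases
        case 1
        then show ?thesis
          using le_trans[OF imp join_right[of ?e c]] by (simp add: meet_comm)
      next
        case 2
        then show ?thesis
          by (auto intro!: meet_left_mono join_left)
      qed
    qed auto
    then show "?i \<sqsubseteq> ?e \<squnion> c"
      using top top_meet[of ?i] by (simp add: eq_is_equal)
  qed
  let ?F = "(\<lambda>\<epsilon>. {x :: real. \<epsilon> < \<bar>x\<bar>}) ` {0<..}"
  have opF: "open {x :: real. \<epsilon> < \<bar>x\<bar>}" for \<epsilon>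
    by (intro open_Collect_less continuous_intros)
  have "UNIV - {0} = \<Union>?F"
    using dense[of 0 "\<bar>x\<bar>" for x :: real] by auto
  then have d_sup: "d = \<Squnion>(h ` ?F)"
    unfolding d_eq using frame_hom_opens_Union[OF h, of ?F] opF by auto
  have "\<Squnion>(h ` ?F) \<sqinter> y \<sqsubseteq> c"
  proof (rule sup_meet_le)
    fix a assume "a \<in> h ` ?F"
    then obtain \<epsilon> where \<epsilon>: "\<epsilon> > 0" and a: "a = h {x. \<epsilon> < \<bar>x\<bar>}"
      by auto
    have aL [simp]: "a \<in> carrier L"
      using opF by (simp add: a)
    have "y \<sqinter> a \<sqsubseteq> (h (ball 0 \<epsilon>) \<squnion> c) \<sqinter> a"
      using y y_le[OF \<epsilon>] by (intro meet_mono) (auto simp: le_refl)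
    also have "\<dots> \<sqsubseteq> c"
      unfolding join_def
    proof (rule sup_meet_le)
      fix b assume "b \<in> {h (ball 0 \<epsilon>), c}"
      then consider "b = h (ball 0 \<epsilon>)" | "b = c" by blast
      then show "b \<sqinter> a \<sqsubseteq> c"
      proof cases
        case 1
        have "h (ball 0 \<epsilon>) \<sqinter> a = h (ball 0 \<epsilon> \<inter> {x. \<epsilon> < \<bar>x\<bar>})"
          using h opF unfolding a frame_hom_opens_iff by simp
        also have "ball 0 \<epsilon> \<inter> {x. \<epsilon> < \<bar>x\<bar>} = {}"
          by auto
        finally show ?thesis
          using 1 frame_hom_opens_empty[OF h] by (simp add: bottom_lower)
      next
        case 2
        then show ?thesis by (auto intro: meet_left)
      qed
    qed auto
    finally show "a \<sqinter> y \<sqsubseteq> c"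
      using y by (simp add: meet_comm)
  qed (use y opF in auto)
  then show "y \<sqsubseteq> ?i"
    using y by (subst le_heyting_imp_iff) (auto simp: d_sup[symmetric] meet_comm)
qed simp

text \<open>Implication turns joins on the left and meets on the right into meets. Complete
  regularity writes \<open>x\<close> as a join of cozero elements \<open>d\<close>, so
  \<open>heyting_imp L x s\<close> is the meet of all \<open>heyting_imp L d c\<close> with
  \<open>c\<close> a cozero element above \<open>s\<close>, and \<open>heyting_imp_Coz\<close>
  handles each of these.\<close>

lemma is_sublocale_coz_meets:
  assumes "completely_regular L"
  shows "is_sublocale L coz_meets"
  unfolding is_sublocale_def
proof (intro conjI allI impI ballI)
  show "coz_meets \<subseteq> carrier L" by (rule coz_meets_carrier)
  fix B assume "B \<subseteq> coz_meets"
  then have B: "B \<subseteq> carrier L" and coz: "\<And>b. b \<in> B \<Longrightarrow> b \<in> coz_meets"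
    using coz_meets_carrier by auto
  show "\<Sqinter>B \<in> coz_meets"
  proof (rule coz_meetsI)
    fix y assume y: "y \<in> carrier L" and le: "\<And>c. \<lbrakk>c \<in> Coz L; \<Sqinter>B \<sqsubseteq> c\<rbrakk> \<Longrightarrow> y \<sqsubseteq> c"
    show "y \<sqsubseteq> \<Sqinter>B"
    proof (rule inf_greatest[OF B y])
      fix b assume b: "b \<in> B"
      show "y \<sqsubseteq> b"
      proof (rule coz_meetsD[OF coz[OF b] y])
        fix c assume c: "c \<in> Coz L" "b \<sqsubseteq> c"
        have "\<Sqinter>B \<sqsubseteq> c"
          by (rule le_trans[OF inf_lower[OF B b] c(2)]) (use B b c Coz_carrier in auto)
        then show "y \<sqsubseteq> c"
          using c le by blast
      qed
    qed
  qed (use B in simp)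
next
  fix x s assume x: "x \<in> carrier L" and s: "s \<in> coz_meets"
  then have sL: "s \<in> carrier L"
    using coz_meets_carrier by auto
  let ?i = "heyting_imp L x s"
  have imp: "?i \<sqinter> x \<sqsubseteq> s"
    using le_heyting_imp_iff[of ?i x s] x sL by (simp add: le_refl)
  obtain D where D: "D \<subseteq> Coz L" and x_eq: "x = \<Squnion>D"
    using assms x unfolding completely_regular_def by blast
  have DL: "D \<subseteq> carrier L"
    using D Coz_carrier by auto
  show "?i \<in> coz_meets"
  proof (rule coz_meetsI)
    fix y assume y: "y \<in> carrier L" and le: "\<And>c. \<lbrakk>c \<in> Coz L; ?i \<sqsubseteq> c\<rbrakk> \<Longrightarrow> y \<sqsubseteq> c"
    have "\<Squnion>D \<sqinter> y \<sqsubseteq> s"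
    proof (rule sup_meet_le[OF DL y sL])
      fix d assume d: "d \<in> D"
      then have dL: "d \<in> carrier L" and dx: "d \<sqsubseteq> x"
        using DL by (auto simp: x_eq intro: sup_upper)
      show "d \<sqinter> y \<sqsubseteq> s"
      proof (rule coz_meetsD[OF s])
        fix c assume c: "c \<in> Coz L" and sc: "s \<sqsubseteq> c"
        then have cL: "c \<in> carrier L"
          using Coz_carrier by auto
        have "?i \<sqinter> d \<sqsubseteq> ?i \<sqinter> x"
          using dL x dx by (intro meet_mono) (auto simp: le_refl)
        also have "\<dots> \<sqsubseteq> s" by (rule imp)
        also have "\<dots> \<sqsubseteq> c" by (rule sc)
        finally have i_le: "?i \<sqsubseteq> heyting_imp L d c"
          using dL cL sL x by (subst le_heyting_imp_iff) auto
        \<comment> \<open>By \<open>i_le\<close>, a cozero element above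
          \<open>heyting_imp L d c\<close> is also above \<open>?i\<close>, hence above
          \<open>y\<close>.\<close>
        have "y \<sqsubseteq> heyting_imp L d c"
        proof (rule coz_meetsD[OF heyting_imp_Coz y])
          fix c' assume c': "c' \<in> Coz L" "heyting_imp L d c \<sqsubseteq> c'"
          then show "y \<sqsubseteq> c'"
            using le[OF c'(1)] le_trans[OF i_le c'(2)] Coz_carrier by auto
        qed (use d D c in auto)
        then show "d \<sqinter> y \<sqsubseteq> c"
          using y dL cL by (subst (asm) le_heyting_imp_iff) (auto simp: meet_comm)
      qed (use dL y in simp)
    qed
    then show "y \<sqsubseteq> ?i"
      using x y sL by (subst le_heyting_imp_iff) (auto simp: x_eq[symmetric] meet_comm)
  qed simp
qed

section \<open>The nucleus of a sublocale, and well-embeddedness\<close>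

lemma frame_hom_nucleus:
  assumes S: "is_sublocale L S"
  shows "frame_hom L (induced L S) (\<lambda>x. \<Sqinter>{s \<in> S. x \<sqsubseteq> s})"
proof -
  let ?S = "induced L S" and ?\<nu> = "\<lambda>x. \<Sqinter>{s \<in> S. x \<sqsubseteq> s}"
  interpret S: frame ?S
    by (rule frame_induced[OF S])
  have SL: "S \<subseteq> carrier L" and S_inf: "\<And>A. A \<subseteq> S \<Longrightarrow> \<Sqinter>A \<in> S"
    and S_imp: "\<And>x s. \<lbrakk>x \<in> carrier L; s \<in> S\<rbrakk> \<Longrightarrow> heyting_imp L x s \<in> S"
    using S by (auto simp: is_sublocale_def)
  have \<nu>S: "?\<nu> x \<in> S" for x
    by (rule S_inf) auto
  then have \<nu>L: "?\<nu> x \<in> carrier L" for x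
    using SL by blast
  have le_\<nu>: "x \<sqsubseteq> ?\<nu> x" if "x \<in> carrier L" for x
    by (rule inf_greatest) (use that SL in auto)
  have \<nu>_le: "?\<nu> x \<sqsubseteq> s" if "s \<in> S" "x \<sqsubseteq> s" for x s
    by (rule inf_lower) (use that SL in auto)
  have \<nu>_mono: "?\<nu> x \<sqsubseteq> ?\<nu> y" if "x \<sqsubseteq> y" "x \<in> carrier L" "y \<in> carrier L" for x y
    using \<nu>S le_trans[OF that(1) le_\<nu>] that \<nu>L by (intro \<nu>_le) auto
  \<comment> \<open>\<open>?\<nu>\<close> is left adjoint to the inclusion of \<open>S\<close> into
    \<open>L\<close>, and therefore takes joins of \<open>L\<close> to joins of
    \<open>S\<close>.\<close>
  have sup: "?\<nu> (\<Squnion>A) = \<Squnion>\<^bsub>?S\<^esub>(?\<nu> ` A)" if A: "A \<subseteq> carrier L" for A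
  proof -
    have img: "?\<nu> ` A \<subseteq> carrier ?S"
      using \<nu>S by auto
    have tS: "\<Squnion>\<^bsub>?S\<^esub>(?\<nu> ` A) \<in> S"
      using S.sup_closed[OF img] by simp
    have "?\<nu> (\<Squnion>A) \<sqsubseteq> \<Squnion>\<^bsub>?S\<^esub>(?\<nu> ` A)"
    proof (rule \<nu>_le[OF tS sup_least[OF A]])
      show tL: "\<Squnion>\<^bsub>?S\<^esub>(?\<nu> ` A) \<in> carrier L"
        using tS SL by blast
      fix a assume a: "a \<in> A"
      have "?\<nu> a \<sqsubseteq> \<Squnion>\<^bsub>?S\<^esub>(?\<nu> ` A)"
        using S.sup_upper[OF img] a by simp
      moreover have "a \<in> carrier L"
        using a A by blast
      ultimately show "a \<sqsubseteq> \<Squnion>\<^bsub>?S\<^esub>(?\<nu> ` A)"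
        using le_trans[OF le_\<nu> _ _ \<nu>L tL] by blast
    qed
    moreover have "\<Squnion>\<^bsub>?S\<^esub>(?\<nu> ` A) \<sqsubseteq>\<^bsub>?S\<^esub> ?\<nu> (\<Squnion>A)"
      by (rule S.sup_least[OF img])
        (use \<nu>S A in \<open>auto intro!: \<nu>_mono sup_upper\<close>)
    ultimately show ?thesis
      using \<nu>S tS SL by (intro le_antisym) auto
  qed
  have meet: "?\<nu> (a \<sqinter> b) = ?\<nu> a \<sqinter>\<^bsub>?S\<^esub> ?\<nu> b" if ab: "a \<in> carrier L" "b \<in> carrier L" for a b
  proof -
    let ?m = "?\<nu> a \<sqinter>\<^bsub>?S\<^esub> ?\<nu> b"
    have mS: "?m \<in> S"
      using S.meet_closed[of "?\<nu> a" "?\<nu> b"] \<nu>S by simp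
    then have mL: "?m \<in> carrier L"
      using SL by blast
    have "?\<nu> (a \<sqinter> b) \<sqsubseteq>\<^bsub>?S\<^esub> ?m"
      by (rule S.meet_le) (use \<nu>S ab in \<open>auto intro!: \<nu>_mono meet_left meet_right\<close>)
    moreover have "?m \<sqsubseteq> ?\<nu> (a \<sqinter> b)"
    proof (rule inf_greatest)
      fix s assume s: "s \<in> {s \<in> S. a \<sqinter> b \<sqsubseteq> s}"
      then have sS: "s \<in> S" and sL: "s \<in> carrier L"
        using SL by auto
      \<comment> \<open>Implications into \<open>s\<close> belong to \<open>S\<close>, so an
        inequality \<open>a \<sqsubseteq> heyting_imp L b s\<close> survives applying
        \<open>?\<nu>\<close> to its left side. Doing this for \<open>a\<close>, exchanging the two
        arguments by adjunction, and doing it for \<open>b\<close> bounds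
        \<open>?\<nu> a \<sqinter> ?\<nu> b\<close> by \<open>s\<close>.\<close>
      have "a \<sqsubseteq> heyting_imp L b s"
        using s ab sL by (subst le_heyting_imp_iff) auto
      then have "?\<nu> a \<sqsubseteq> heyting_imp L b s"
        using S_imp ab sS by (intro \<nu>_le) auto
      then have "b \<sqsubseteq> heyting_imp L (?\<nu> a) s"
        using ab sL \<nu>L by (simp add: le_heyting_imp_iff meet_comm)
      then have "?\<nu> b \<sqsubseteq> heyting_imp L (?\<nu> a) s"
        using S_imp \<nu>L sS by (intro \<nu>_le) auto
      then have "?\<nu> a \<sqinter> ?\<nu> b \<sqsubseteq> s"
        using sL \<nu>L by (simp add: le_heyting_imp_iff meet_comm)
      moreover have "?m \<sqsubseteq> ?\<nu> a \<sqinter> ?\<nu> b"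
        using S.meet_left[of "?\<nu> a" "?\<nu> b"] S.meet_right[of "?\<nu> a" "?\<nu> b"] \<nu>S \<nu>L mS SL
        by (intro meet_le) auto
      ultimately show "?m \<sqsubseteq> s"
        using le_trans[OF _ _ mL meet_closed[OF \<nu>L \<nu>L] sL] by blast
    qed (use mS SL in auto)
    ultimately show ?thesis
      using \<nu>S mS SL by (intro le_antisym) auto
  qed
  have top: "?\<nu> \<top> = \<top>\<^bsub>?S\<^esub>"
  proof (rule S.top_eq)
    fix x assume "x \<in> carrier ?S"
    then have "x \<sqsubseteq> \<top>" "x \<in> carrier L"
      using SL by (auto intro: top_higher)
    then show "x \<sqsubseteq>\<^bsub>?S\<^esub> ?\<nu> \<top>"
      using le_trans[OF _ le_\<nu>[of \<top>]] \<nu>L by auto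
  qed (use \<nu>S in auto)
  have "complete_lattice L" "lattice L" "complete_lattice ?S" "lattice ?S"
    by unfold_locales
  then show ?thesis
    unfolding frame_hom_def sup_pres_def meet_pres_def
    using \<nu>S sup meet top by auto
qed

text \<open>The nucleus fixes the elements of \<open>S\<close>. Composed with a homomorphism
  exhibiting \<open>c\<close> as a cozero element of \<open>L\<close>, it exhibits the same
  \<open>c\<close> as one of \<open>induced L S\<close>.\<close>

lemma well_embedded_if_Coz_subset:
  assumes S: "is_sublocale L S" and coz: "Coz L \<subseteq> S"
  shows "well_embedded L S"
  unfolding well_embedded_def
proof
  let ?\<nu> = "\<lambda>x. \<Sqinter>{s \<in> S. x \<sqsubseteq> s}"
  fix c assume c: "c \<in> Coz L"
  then obtain h where h: "frame_hom (opens (euclidean :: real topology)) L h" "c = h (UNIV - {0})"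
    unfolding Coz_def by auto
  have SL: "S \<subseteq> carrier L"
    using S by (simp add: is_sublocale_def)
  have "c = ?\<nu> c"
  proof (rule le_antisym)
    show "c \<sqsubseteq> ?\<nu> c"
      by (rule inf_greatest) (use SL c Coz_carrier in auto)
    show "?\<nu> c \<sqsubseteq> c"
      by (rule inf_lower) (use SL c coz in \<open>auto simp: le_refl\<close>)
  qed (use SL c coz in \<open>auto intro!: inf_closed\<close>)
  moreover have "frame_hom (opens euclidean) (induced L S) (?\<nu> \<circ> h)"
    by (rule frame_hom_compose[OF h(1) frame_hom_nucleus[OF S]])
  ultimately show "c \<in> Coz (induced L S)"
    unfolding Coz_def using h(2) by (auto intro!: exI[of _ "?\<nu> \<circ> h"])
qed

text \<open>\<open>induced L S\<close> is itself a frame, and its cozero elements lie in its carrier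
  \<open>S\<close>.\<close>

lemma well_embedded_imp_Coz_subset:
  assumes "is_sublocale L S" and "well_embedded L S"
  shows "Coz L \<subseteq> S"
  using assms frame.Coz_carrier[OF frame_induced] by (fastforce simp: well_embedded_def)

end

section \<open>Perfect regularity in terms of dense well-embedded sublocales\<close>

theorem theorem3p8:
  fixes L :: "('a, 'b) gorder_scheme"
  assumes "frame L" and "completely_regular L"
  shows "perfectly_regular L \<longleftrightarrow>
    \<not> (\<exists>S. dense_sublocale L S \<and> S \<noteq> carrier L \<and> well_embedded L S)"
proof -
  interpret frame L by fact
  show ?thesis
  proof
    assume perf: "perfectly_regular L"
    have "S = carrier L" if "dense_sublocale L S" "well_embedded L S" for S
    proof -
      have S: "is_sublocale L S"
        using that by (simp add: dense_sublocale_def)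
      then have SL: "S \<subseteq> carrier L" and S_inf: "\<And>A. A \<subseteq> S \<Longrightarrow> \<Sqinter>\<^bsub>L\<^esub>A \<in> S"
        by (simp_all add: is_sublocale_def)
      have coz: "Coz L \<subseteq> S"
        using S \<open>well_embedded L S\<close> by (rule well_embedded_imp_Coz_subset)
      have "a \<in> S" if a: "a \<in> carrier L" for a
      proof -
        have "\<exists>A\<subseteq>Coz L. a = \<Sqinter>\<^bsub>L\<^esub>A"
          using perf a by (simp add: perfectly_regular_def)
        then show ?thesis
          using S_inf coz by auto
      qed
      then show ?thesis
        using SL by auto
    qed
    then show "\<not> (\<exists>S. dense_sublocale L S \<and> S \<noteq> carrier L \<and> well_embedded L S)"
      by blast
  next
    assume none: "\<not> (\<exists>S. dense_sublocale L S \<and> S \<noteq> carrier L \<and> well_embedded L S)"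
    \<comment> \<open>Density holds because bottom is a cozero element, and
      \<open>Coz L \<subseteq> coz_meets\<close> gives well-embeddedness.\<close>
    have "dense_sublocale L coz_meets" "well_embedded L coz_meets"
      using is_sublocale_coz_meets[OF assms(2)] bottom_in_Coz Coz_subset_coz_meets
      by (auto simp: dense_sublocale_def intro: well_embedded_if_Coz_subset)
    then have "coz_meets = carrier L"
      using none by blast
    then show "perfectly_regular L"
      using assms(2) unfolding perfectly_regular_def completely_regular_def coz_meets_def by blast
  qed
qed

end
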